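(* Let $R$ be a commutative ring with identity. Then $\pi_1(SL_2(R[X]))\cong \pi_1(SL_2(R))$ as groups. Moreover, $\pi_1(SL_2(R[X_1,X_2,\ldots,X_n]))\cong \pi_1(SL_2(R))$ for all $n\in\mathbb{N}$.
   Context: For a commutative ring $R$ with identity, $SL_2(R)$ is the group of $2\times 2$ matrices over $R$ of determinant $1$ and $I_2$ is the identity matrix. Let $L=\{\alpha(T)\in SL_2(R[T]) \mid \alpha(0)=\alpha(1)=I_2\}$ (polynomial loops based at $I_2$). Two loops $\alpha(T),\beta(T)\in L$ are equivalent, $\alpha(T)\sim\beta(T)$, if there exists $\gamma(T,S)\in SL_2(R[T,S])$ with $\gamma(T,0)=\alpha(T)$, $\gamma(T,1)=\beta(T)$ and $\gamma(0,S)=\gamma(1,S)=I_2$. The set of equivalence classes is an abelian group under $[\alpha(T)]*[\beta(T)]=[\alpha(T)\beta(T)]$ (matrix product); it is denoted $\pi_1(SL_2(R))$ and called the algebraic fundamental group of $R$. *)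

theory Defs
  imports
    "HOL-Analysis.Determinants"
    "HOL-Computational_Algebra.Polynomial"
    "HOL-Algebra.Group"
    "HOL-Library.Poly_Mapping"
begin

text \<open>
  The polynomial ring in finitely many variables indexed by the finite type \<open>'n\<close>:
  finitely supported families of coefficients indexed by exponent vectors, with the
  convolution product of \<^theory>\<open>HOL-Library.Poly_Mapping\<close>. The number of variables is
  \<open>CARD('n)\<close>.
\<close>

type_synonym ('a, 'n) mpoly = "('n \<Rightarrow>\<^sub>0 nat) \<Rightarrow>\<^sub>0 'a"

definition SL2 :: "('a::comm_ring_1 ^ 2 ^ 2) set" where
  "SL2 = {A. det A = 1}"

definition poly_loops :: "('a::comm_ring_1 poly ^ 2 ^ 2) set" where
  "poly_loops = {\<alpha> \<in> SL2. map_matrix (\<lambda>p. poly p 0) \<alpha> = mat 1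
                        \<and> map_matrix (\<lambda>p. poly p 1) \<alpha> = mat 1}"

text \<open>
  \<open>R[T, S]\<close> is rendered as \<open>R[T][S]\<close>: an element of \<open>'a poly poly\<close> is a polynomial in \<open>S\<close>
  whose coefficients are polynomials in \<open>T\<close>. So the specialization of the outer variable
  is \<open>S\<close>, with value in \<open>R[T]\<close>, and \<open>map_poly\<close> specializes \<open>T\<close>, with value in \<open>R[S]\<close>.
\<close>

definition spec_S :: "'a::comm_ring_1 \<Rightarrow> 'a poly poly \<Rightarrow> 'a poly" where
  "spec_S s p = poly p [:s:]"

definition spec_T :: "'a::comm_ring_1 \<Rightarrow> 'a poly poly \<Rightarrow> 'a poly" where
  "spec_T t p = map_poly (\<lambda>c. poly c t) p"

definition loop_rel :: "('a::comm_ring_1 poly ^ 2 ^ 2) rel" where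
  "loop_rel = {(\<alpha>, \<beta>). \<alpha> \<in> poly_loops \<and> \<beta> \<in> poly_loops \<and>
     (\<exists>\<gamma> \<in> SL2. map_matrix (spec_S 0) \<gamma> = \<alpha> \<and> map_matrix (spec_S 1) \<gamma> = \<beta> \<and>
               map_matrix (spec_T 0) \<gamma> = mat 1 \<and> map_matrix (spec_T 1) \<gamma> = mat 1)}"

text \<open>
  The product of two classes is written as a union over representatives; since the relation
  is a congruence, it is the class of the product of any two representatives
  (lemma \<open>loop_class_mult\<close> below).
\<close>

definition pi1_SL2 :: "'a::comm_ring_1 itself \<Rightarrow> ('a poly ^ 2 ^ 2) set monoid" where
  "pi1_SL2 _ = \<lparr>carrier = poly_loops // loop_rel,
                mult = (\<lambda>A B. \<Union>\<alpha>\<in>A. \<Union>\<beta>\<in>B. loop_rel `` {\<alpha> ** \<beta>}),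
                one = loop_rel `` {mat 1}\<rparr>"


section \<open>The relation is a congruence and the quotient is an abelian group\<close>

lemma mat2_eq_iff:
  "A = B \<longleftrightarrow> A$1$1 = B$1$1 \<and> A$1$2 = B$1$2 \<and> A$2$1 = B$2$1 \<and> A$2$2 = B$2$2"
  for A B :: "'a ^ 2 ^ 2"
  by (auto simp: vec_eq_iff forall_2)

lemma mat2_mult_nth: "(A ** B) $ i $ j = A$i$1 * B$1$j + A$i$2 * B$2$j"
  for A B :: "'a::comm_ring_1 ^ 2 ^ 2"
  by (simp add: matrix_matrix_mult_def sum_2)

lemma mat2_one_nth [simp]:
  "(mat 1 :: 'a::comm_ring_1 ^ 2 ^ 2) $ 1 $ 1 = 1" "(mat 1 :: 'a ^ 2 ^ 2) $ 1 $ 2 = 0"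
  "(mat 1 :: 'a ^ 2 ^ 2) $ 2 $ 1 = 0" "(mat 1 :: 'a ^ 2 ^ 2) $ 2 $ 2 = 1"
  by (simp_all add: mat_def)

definition adj2 :: "'a::comm_ring_1 ^ 2 ^ 2 \<Rightarrow> 'a ^ 2 ^ 2" where
  "adj2 A = vector [vector [A$2$2, - A$1$2], vector [- A$2$1, A$1$1]]"

lemma adj2_nth [simp]:
  "adj2 A $ 1 $ 1 = A$2$2" "adj2 A $ 1 $ 2 = - A$1$2"
  "adj2 A $ 2 $ 1 = - A$2$1" "adj2 A $ 2 $ 2 = A$1$1"
  by (simp_all add: adj2_def)

lemma adj2_left: "A \<in> SL2 \<Longrightarrow> adj2 A ** A = mat 1"
  and adj2_right: "A \<in> SL2 \<Longrightarrow> A ** adj2 A = mat 1"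
  by (simp_all add: SL2_def det_2 mat2_eq_iff mat2_mult_nth algebra_simps)

lemma adj2_one [simp]: "adj2 (mat 1) = mat 1"
  by (simp add: mat2_eq_iff)

lemma SL2_mult: "A \<in> SL2 \<Longrightarrow> B \<in> SL2 \<Longrightarrow> A ** B \<in> SL2"
  by (simp add: SL2_def det_mul)

lemma SL2_one [simp]: "mat 1 \<in> SL2"
  by (simp add: SL2_def)

lemma SL2_adj2: "A \<in> SL2 \<Longrightarrow> adj2 A \<in> SL2"
  by (simp add: SL2_def det_2 algebra_simps)

definition rhom :: "('a::comm_ring_1 \<Rightarrow> 'b::comm_ring_1) \<Rightarrow> bool" where
  "rhom f \<longleftrightarrow> (\<forall>x y. f (x + y) = f x + f y) \<and> (\<forall>x y. f (x * y) = f x * f y) \<and> f 1 = 1"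

lemma rhomI:
  "(\<And>x y. f (x + y) = f x + f y) \<Longrightarrow> (\<And>x y. f (x * y) = f x * f y) \<Longrightarrow> f 1 = 1 \<Longrightarrow> rhom f"
  by (simp add: rhom_def)

lemma
  assumes "rhom f"
  shows rhom_add: "f (x + y) = f x + f y" and rhom_mult: "f (x * y) = f x * f y"
    and rhom_one: "f 1 = 1" and rhom_zero: "f 0 = 0" and rhom_uminus: "f (- x) = - f x"
    and rhom_diff: "f (x - y) = f x - f y"
proof -
  show add: "\<And>x y. f (x + y) = f x + f y" and "f (x * y) = f x * f y" and "f 1 = 1"
    using assms by (simp_all add: rhom_def)
  have "f 0 + f 0 = f 0" using add[of 0 0] by simp
  then show z: "f 0 = 0" by simp
  have um: "f (- x) = - f x" for x
    using add[of "- x" x] z by (simp add: eq_neg_iff_add_eq_0)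
  then show "f (- x) = - f x" .
  show "f (x - y) = f x - f y" using add[of x "- y"] um[of y] by simp
qed

lemma rhom_comp: "rhom f \<Longrightarrow> rhom g \<Longrightarrow> rhom (\<lambda>x. f (g x))"
  by (simp add: rhom_def)

lemma map_matrix_mult: "rhom f \<Longrightarrow> map_matrix f (A ** B) = map_matrix f A ** map_matrix f B"
  for A B :: "'a::comm_ring_1 ^ 2 ^ 2"
  by (simp add: mat2_eq_iff mat2_mult_nth rhom_add rhom_mult)

lemma map_matrix_one: "rhom f \<Longrightarrow> map_matrix f (mat 1 :: 'a::comm_ring_1 ^ 2 ^ 2) = mat 1"
  by (simp add: mat2_eq_iff rhom_one rhom_zero)

lemma map_matrix_adj2: "rhom f \<Longrightarrow> map_matrix f (adj2 A) = adj2 (map_matrix f A)"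
  by (simp add: mat2_eq_iff rhom_uminus)

lemma map_matrix_SL2: "rhom f \<Longrightarrow> A \<in> SL2 \<Longrightarrow> map_matrix f A \<in> SL2"
proof -
  assume f: "rhom f" and A: "A \<in> SL2"
  have "det (map_matrix f A) = f (det A)"
    by (simp add: det_2 f rhom_diff rhom_mult)
  then show ?thesis using A f by (simp add: SL2_def rhom_one)
qed

lemma map_matrix_comp: "map_matrix f (map_matrix g A) = map_matrix (\<lambda>x. f (g x)) A"
  by (simp add: vec_eq_iff)

lemma map_matrix_ident: "map_matrix (\<lambda>x. x) A = A"
  by (simp add: vec_eq_iff)

lemma map_poly_rhom:
  assumes f: "rhom (f :: 'a::comm_ring_1 \<Rightarrow> 'b::comm_ring_1)"
  shows "rhom (map_poly f)"
proof (rule rhomI)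
  note [simp] = rhom_add[OF f] rhom_mult[OF f] rhom_one[OF f] rhom_zero[OF f]
  show add: "map_poly f (p + q) = map_poly f p + map_poly f q" for p q
    by (rule poly_eqI) (simp add: coeff_map_poly)
  have sm: "map_poly f (smult c q) = smult (f c) (map_poly f q)" for c q
    by (rule poly_eqI) (simp add: coeff_map_poly)
  show "map_poly f (p * q) = map_poly f p * map_poly f q" for p q
  proof (induction p)
    case 0 show ?case by simp
  next
    case (pCons a p)
    then show ?case
      by (simp add: add sm mult_pCons_left map_poly_pCons)
  qed
  show "map_poly f 1 = 1" by simp
qed

lemma poly_rhom: "rhom (\<lambda>p. poly p x)"
  by (rule rhomI) simp_all

lemma const_rhom: "rhom (\<lambda>c. [:c:])"
  by (rule rhomI) (simp_all add: one_pCons)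

lemma spec_S_rhom: "rhom (spec_S s)"
  unfolding spec_S_def by (rule poly_rhom)

lemma spec_T_rhom: "rhom (spec_T t)"
  unfolding spec_T_def by (rule map_poly_rhom[OF poly_rhom])

lemma poly_loopsD:
  assumes "\<alpha> \<in> poly_loops"
  shows "\<alpha> \<in> SL2" "map_matrix (\<lambda>p. poly p 0) \<alpha> = mat 1" "map_matrix (\<lambda>p. poly p 1) \<alpha> = mat 1"
  using assms by (simp_all add: poly_loops_def)

lemma poly_loops_one [simp]: "mat 1 \<in> poly_loops"
  by (simp add: poly_loops_def map_matrix_one poly_rhom)

lemma poly_loops_mult: "\<alpha> \<in> poly_loops \<Longrightarrow> \<beta> \<in> poly_loops \<Longrightarrow> \<alpha> ** \<beta> \<in> poly_loops"
  by (simp add: poly_loops_def SL2_mult map_matrix_mult poly_rhom)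

lemma poly_loops_adj2: "\<alpha> \<in> poly_loops \<Longrightarrow> adj2 \<alpha> \<in> poly_loops"
  by (simp add: poly_loops_def SL2_adj2 map_matrix_adj2 poly_rhom)

lemma loop_relI:
  assumes "\<alpha> \<in> poly_loops" "\<beta> \<in> poly_loops" "\<gamma> \<in> SL2"
    "map_matrix (spec_S 0) \<gamma> = \<alpha>" "map_matrix (spec_S 1) \<gamma> = \<beta>"
    "map_matrix (spec_T 0) \<gamma> = mat 1" "map_matrix (spec_T 1) \<gamma> = mat 1"
  shows "(\<alpha>, \<beta>) \<in> loop_rel"
  using assms by (auto simp: loop_rel_def)

lemma loop_relE:
  assumes "(\<alpha>, \<beta>) \<in> loop_rel"
  obtains \<gamma> where "\<alpha> \<in> poly_loops" "\<beta> \<in> poly_loops" "\<gamma> \<in> SL2"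
    "map_matrix (spec_S 0) \<gamma> = \<alpha>" "map_matrix (spec_S 1) \<gamma> = \<beta>"
    "map_matrix (spec_T 0) \<gamma> = mat 1" "map_matrix (spec_T 1) \<gamma> = mat 1"
  using assms by (auto simp: loop_rel_def)

definition const_S :: "'a::comm_ring_1 poly ^ 2 ^ 2 \<Rightarrow> 'a poly poly ^ 2 ^ 2" where
  "const_S \<alpha> = map_matrix (\<lambda>p. [:p:]) \<alpha>"

lemma const_S_SL2: "\<alpha> \<in> SL2 \<Longrightarrow> const_S \<alpha> \<in> SL2"
  unfolding const_S_def by (rule map_matrix_SL2[OF const_rhom])

lemma spec_S_const_S: "map_matrix (spec_S s) (const_S \<alpha>) = \<alpha>"
  by (simp add: const_S_def map_matrix_comp spec_S_def map_matrix_ident)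

lemma spec_T_const_S:
  "map_matrix (spec_T t) (const_S \<alpha>) = map_matrix (\<lambda>c. [:c:]) (map_matrix (\<lambda>p. poly p t) \<alpha>)"
  by (simp add: const_S_def map_matrix_comp spec_T_def map_poly_pCons)

lemma spec_T_const_S_loop:
  assumes "\<alpha> \<in> poly_loops"
  shows "map_matrix (spec_T 0) (const_S \<alpha>) = mat 1" "map_matrix (spec_T 1) (const_S \<alpha>) = mat 1"
  by (simp_all add: spec_T_const_S poly_loopsD[OF assms] map_matrix_one const_rhom)

lemma loop_rel_refl: "\<alpha> \<in> poly_loops \<Longrightarrow> (\<alpha>, \<alpha>) \<in> loop_rel"
  by (rule loop_relI[of _ _ "const_S \<alpha>"])
    (simp_all add: const_S_SL2 poly_loopsD spec_S_const_S spec_T_const_S_loop)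

lemma loop_rel_mult:
  assumes "(\<alpha>, \<beta>) \<in> loop_rel" "(\<alpha>', \<beta>') \<in> loop_rel"
  shows "(\<alpha> ** \<alpha>', \<beta> ** \<beta>') \<in> loop_rel"
proof -
  obtain \<gamma> \<gamma>' where
    "\<alpha> \<in> poly_loops" "\<beta> \<in> poly_loops" "\<gamma> \<in> SL2"
    "map_matrix (spec_S 0) \<gamma> = \<alpha>" "map_matrix (spec_S 1) \<gamma> = \<beta>"
    "map_matrix (spec_T 0) \<gamma> = mat 1" "map_matrix (spec_T 1) \<gamma> = mat 1"
    "\<alpha>' \<in> poly_loops" "\<beta>' \<in> poly_loops" "\<gamma>' \<in> SL2"
    "map_matrix (spec_S 0) \<gamma>' = \<alpha>'" "map_matrix (spec_S 1) \<gamma>' = \<beta>'"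
    "map_matrix (spec_T 0) \<gamma>' = mat 1" "map_matrix (spec_T 1) \<gamma>' = mat 1"
    using assms by (elim loop_relE) blast
  then show ?thesis
    by (intro loop_relI[of _ _ "\<gamma> ** \<gamma>'"])
      (simp_all add: SL2_mult poly_loops_mult map_matrix_mult spec_S_rhom spec_T_rhom)
qed

lemma loop_rel_adj2:
  assumes "(\<alpha>, \<beta>) \<in> loop_rel"
  shows "(adj2 \<alpha>, adj2 \<beta>) \<in> loop_rel"
proof -
  obtain \<gamma> where
    "\<alpha> \<in> poly_loops" "\<beta> \<in> poly_loops" "\<gamma> \<in> SL2"
    "map_matrix (spec_S 0) \<gamma> = \<alpha>" "map_matrix (spec_S 1) \<gamma> = \<beta>"
    "map_matrix (spec_T 0) \<gamma> = mat 1" "map_matrix (spec_T 1) \<gamma> = mat 1"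
    using assms by (elim loop_relE) blast
  then show ?thesis
    by (intro loop_relI[of _ _ "adj2 \<gamma>"])
      (simp_all add: SL2_adj2 poly_loops_adj2 map_matrix_adj2 spec_S_rhom spec_T_rhom)
qed

lemma loop_rel_sym:
  assumes ab: "(\<alpha>, \<beta>) \<in> loop_rel"
  shows "(\<beta>, \<alpha>) \<in> loop_rel"
proof -
  have loops: "\<alpha> \<in> poly_loops" "\<beta> \<in> poly_loops" using ab by (auto simp: loop_rel_def)
  then have SL: "\<alpha> \<in> SL2" "\<beta> \<in> SL2" by (auto dest: poly_loopsD)
  have "(\<alpha> ** adj2 \<alpha> ** \<beta>, \<alpha> ** adj2 \<beta> ** \<beta>) \<in> loop_rel"
    by (intro loop_rel_mult loop_rel_adj2 loop_rel_refl loops ab)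
  moreover have "\<alpha> ** adj2 \<beta> ** \<beta> = \<alpha> ** (adj2 \<beta> ** \<beta>)"
    by (simp only: matrix_mul_assoc)
  ultimately show ?thesis
    by (simp add: adj2_right[OF SL(1)] adj2_left[OF SL(2)])
qed

lemma loop_rel_trans:
  assumes ab: "(\<alpha>, \<beta>) \<in> loop_rel" and bd: "(\<beta>, \<delta>) \<in> loop_rel"
  shows "(\<alpha>, \<delta>) \<in> loop_rel"
proof -
  have loops: "\<beta> \<in> poly_loops" using ab by (auto simp: loop_rel_def)
  then have SL: "\<beta> \<in> SL2" by (auto dest: poly_loopsD)
  have "(\<alpha> ** (adj2 \<beta> ** \<beta>), \<beta> ** (adj2 \<beta> ** \<delta>)) \<in> loop_rel"
    by (intro loop_rel_mult loop_rel_refl poly_loops_adj2 loops ab bd)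
  then show ?thesis
    using SL by (simp add: adj2_left) (simp add: matrix_mul_assoc adj2_right)
qed

lemma equiv_loop_rel: "equiv poly_loops loop_rel"
proof (rule equivI)
  show "loop_rel \<subseteq> poly_loops \<times> poly_loops"
    by (auto simp: loop_rel_def)
  show "refl_on poly_loops loop_rel"
    by (simp add: refl_on_def loop_rel_refl)
  show "sym loop_rel"
    by (rule symI) (rule loop_rel_sym)
  show "trans loop_rel"
    by (rule transI) (rule loop_rel_trans)
qed

lemma loop_class_mult:
  fixes \<alpha> \<beta> :: "'a::comm_ring_1 poly ^ 2 ^ 2"
  assumes "\<alpha> \<in> poly_loops" "\<beta> \<in> poly_loops"
  shows "loop_rel `` {\<alpha>} \<otimes>\<^bsub>pi1_SL2 TYPE('a)\<^esub> loop_rel `` {\<beta>} = loop_rel `` {\<alpha> ** \<beta>}"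
proof -
  let ?C = "loop_rel `` {\<alpha> ** \<beta>}"
  have "loop_rel `` {\<alpha>' ** \<beta>'} = ?C"
    if "\<alpha>' \<in> loop_rel `` {\<alpha>}" "\<beta>' \<in> loop_rel `` {\<beta>}" for \<alpha>' \<beta>'
  proof -
    have "(\<alpha> ** \<beta>, \<alpha>' ** \<beta>') \<in> loop_rel"
      using that by (intro loop_rel_mult) simp_all
    then show ?thesis
      by (rule equiv_class_eq[OF equiv_loop_rel, symmetric])
  qed
  then have "(\<Union>\<alpha>'\<in>loop_rel `` {\<alpha>}. \<Union>\<beta>'\<in>loop_rel `` {\<beta>}. loop_rel `` {\<alpha>' ** \<beta>'}) =
      (\<Union>\<alpha>'\<in>loop_rel `` {\<alpha>}. \<Union>\<beta>'\<in>loop_rel `` {\<beta>}. ?C)"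
    by (intro SUP_cong refl)
  also have "\<dots> = ?C"
    using equiv_class_self[OF equiv_loop_rel] assms by blast
  finally show ?thesis
    by (simp add: pi1_SL2_def)
qed

text \<open>For the commutativity, contract the second factor along \<open>\<beta>((1 - S) T)\<close>.\<close>

definition shrink :: "'a::comm_ring_1 poly \<Rightarrow> 'a poly poly" where
  "shrink p = poly (map_poly (\<lambda>c. [:[:c:]:]) p) [:[:0, 1:], [:0, -1:]:]"

lemma shrink_rhom: "rhom shrink"
  unfolding shrink_def
  by (intro rhom_comp[OF poly_rhom] map_poly_rhom rhom_comp[OF const_rhom] const_rhom)

lemma shrink_pCons: "shrink (pCons a p) = [:[:a:]:] + [:[:0, 1:], [:0, -1:]:] * shrink p"
  by (simp add: shrink_def map_poly_pCons)

lemma shrink_0 [simp]: "shrink 0 = 0"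
  by (simp add: shrink_def)

lemma spec_S_shrink_0: "spec_S 0 (shrink p) = p"
proof (induction p)
  case (pCons a p)
  then show ?case
    by (simp add: shrink_pCons rhom_add[OF spec_S_rhom] rhom_mult[OF spec_S_rhom])
      (simp add: spec_S_def)
qed (simp add: spec_S_def)

lemma spec_S_shrink_1: "spec_S 1 (shrink p) = [:poly p 0:]"
proof (induction p)
  case (pCons a p)
  then show ?case
    by (simp add: shrink_pCons rhom_add[OF spec_S_rhom] rhom_mult[OF spec_S_rhom])
      (simp add: spec_S_def)
qed (simp add: spec_S_def)

lemma spec_T_shrink_0: "spec_T 0 (shrink p) = [:poly p 0:]"
proof (induction p)
  case (pCons a p)
  have "spec_T 0 [:[:0, 1:], [:0, -1:]:] = (0 :: 'a poly)"
    by (simp add: spec_T_def map_poly_pCons)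
  then show ?case
    by (simp only: shrink_pCons rhom_add[OF spec_T_rhom] rhom_mult[OF spec_T_rhom])
      (simp add: spec_T_def map_poly_pCons)
qed (simp add: spec_T_def)

lemma loop_rel_comm:
  assumes \<alpha>: "\<alpha> \<in> poly_loops" and \<beta>: "\<beta> \<in> poly_loops"
  shows "(\<alpha> ** \<beta>, \<beta> ** \<alpha>) \<in> loop_rel"
proof -
  define b where "b = map_matrix shrink \<beta>"
  have SL: "\<alpha> \<in> SL2" "\<beta> \<in> SL2" using \<alpha> \<beta> by (auto dest: poly_loopsD)
  have bSL: "b \<in> SL2" unfolding b_def by (rule map_matrix_SL2[OF shrink_rhom SL(2)])
  have bS0: "map_matrix (spec_S 0) b = \<beta>"
    by (simp add: b_def map_matrix_comp spec_S_shrink_0 map_matrix_ident)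
  have c: "map_matrix (\<lambda>p. [:poly p 0:]) \<beta> = mat 1"
    using arg_cong[OF poly_loopsD(2)[OF \<beta>], of "map_matrix (\<lambda>c. [:c:])"]
    by (simp add: map_matrix_comp map_matrix_one const_rhom)
  have bS1: "map_matrix (spec_S 1) b = mat 1"
    by (simp add: b_def map_matrix_comp spec_S_shrink_1 c)
  have bT0: "map_matrix (spec_T 0) b = mat 1"
    by (simp add: b_def map_matrix_comp spec_T_shrink_0 c)
  let ?ca = "const_S \<alpha>" and ?cb = "const_S \<beta>"
  define \<gamma> where "\<gamma> = ?ca ** b ** adj2 ?ca ** adj2 b ** (?cb ** ?ca)"
  note hom_simps = map_matrix_mult map_matrix_adj2 spec_S_rhom spec_T_rhom spec_S_const_S
  have \<gamma>SL: "\<gamma> \<in> SL2"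
    unfolding \<gamma>_def by (intro SL2_mult SL2_adj2 const_S_SL2 SL bSL)
  have "map_matrix (spec_S 0) \<gamma> = \<alpha> ** (\<beta> ** (adj2 \<alpha> ** ((adj2 \<beta> ** \<beta>) ** \<alpha>)))"
    by (simp add: \<gamma>_def hom_simps bS0 matrix_mul_assoc)
  then have "map_matrix (spec_S 0) \<gamma> = \<alpha> ** \<beta>"
    by (simp add: adj2_left SL)
  moreover have "map_matrix (spec_S 1) \<gamma> = \<beta> ** \<alpha>"
    by (simp add: \<gamma>_def hom_simps bS1 adj2_right SL)
  moreover have "map_matrix (spec_T 0) \<gamma> = mat 1"
    by (simp add: \<gamma>_def hom_simps bT0 spec_T_const_S_loop \<alpha> \<beta>)
  moreover have "map_matrix (spec_T 1) \<gamma> = mat 1"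
    using map_matrix_SL2[OF spec_T_rhom bSL, of 1]
    by (simp add: \<gamma>_def hom_simps spec_T_const_S_loop \<alpha> \<beta> adj2_right)
  ultimately show ?thesis
    by (intro loop_relI[OF _ _ \<gamma>SL] poly_loops_mult \<alpha> \<beta>)
qed

lemma pi1_SL2_carrier: "carrier (pi1_SL2 TYPE('a)) = (\<lambda>\<alpha>. loop_rel `` {\<alpha>}) ` poly_loops"
  for dummy :: "'a::comm_ring_1"
  by (auto simp: pi1_SL2_def quotient_def)

lemma pi1_SL2_one: "\<one>\<^bsub>pi1_SL2 TYPE('a::comm_ring_1)\<^esub> = loop_rel `` {mat 1}"
  by (simp add: pi1_SL2_def)

lemma comm_group_pi1_SL2: "comm_group (pi1_SL2 TYPE('a::comm_ring_1))"
proof (rule comm_groupI)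
  let ?G = "pi1_SL2 TYPE('a)"
  note pi1_simps = pi1_SL2_carrier pi1_SL2_one loop_class_mult poly_loops_mult
  show "x \<otimes>\<^bsub>?G\<^esub> y \<in> carrier ?G" if "x \<in> carrier ?G" "y \<in> carrier ?G" for x y
    using that by (auto simp: pi1_simps)
  show "\<one>\<^bsub>?G\<^esub> \<in> carrier ?G"
    by (simp add: pi1_simps)
  show "x \<otimes>\<^bsub>?G\<^esub> y \<otimes>\<^bsub>?G\<^esub> z = x \<otimes>\<^bsub>?G\<^esub> (y \<otimes>\<^bsub>?G\<^esub> z)"
    if "x \<in> carrier ?G" "y \<in> carrier ?G" "z \<in> carrier ?G" for x y z
    using that by (auto simp: pi1_simps matrix_mul_assoc)
  show "x \<otimes>\<^bsub>?G\<^esub> y = y \<otimes>\<^bsub>?G\<^esub> x" if "x \<in> carrier ?G" "y \<in> carrier ?G" for x y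
    using that equiv_class_eq[OF equiv_loop_rel loop_rel_comm]
    by (force simp only: pi1_simps)
  show "\<one>\<^bsub>?G\<^esub> \<otimes>\<^bsub>?G\<^esub> x = x" if "x \<in> carrier ?G" for x
    using that by (auto simp: pi1_simps)
  show "\<exists>y\<in>carrier ?G. y \<otimes>\<^bsub>?G\<^esub> x = \<one>\<^bsub>?G\<^esub>" if x_in: "x \<in> carrier ?G" for x
  proof -
    obtain \<alpha> where \<alpha>: "\<alpha> \<in> poly_loops" and x: "x = loop_rel `` {\<alpha>}"
      using x_in unfolding pi1_SL2_carrier by blast
    have "loop_rel `` {adj2 \<alpha>} \<otimes>\<^bsub>?G\<^esub> x = \<one>\<^bsub>?G\<^esub>"
      by (simp only: x loop_class_mult[OF poly_loops_adj2[OF \<alpha>] \<alpha>]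
          adj2_left[OF poly_loopsD(1)[OF \<alpha>]] pi1_SL2_one)
    moreover have "loop_rel `` {adj2 \<alpha>} \<in> carrier ?G"
      unfolding pi1_SL2_carrier using poly_loops_adj2[OF \<alpha>] by (rule imageI)
    ultimately show ?thesis ..
  qed
qed

end

theory Submission
  imports Defs
begin

text \<open>
  A polynomial ring \<open>B\<close> over \<open>A\<close> is contracted onto \<open>A\<close> by the homotopy \<open>X \<mapsto> S X\<close>: it is a ring
  homomorphism \<open>B \<rightarrow> B[S]\<close> that specializes to the identity at \<open>S = 1\<close> and to the retraction
  \<open>X \<mapsto> 0\<close> at \<open>S = 0\<close>. Applied to the coefficients of a loop over \<open>B\<close>, it gives an equivalence with
  its image under \<open>B \<rightarrow> A \<rightarrow> B\<close>, and it fixes both end points because they are \<open>mat 1\<close>. Hence the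
  homomorphisms induced by \<open>A \<rightarrow> B\<close> and \<open>B \<rightarrow> A\<close> are mutually inverse.
\<close>

section \<open>Functoriality of the loop group in the coefficient ring\<close>

lemma rhom_poly_map_poly:
  assumes f: "rhom f"
  shows "poly (map_poly f p) (f x) = f (poly p x)"
  by (induction p) (simp_all add: map_poly_pCons rhom_zero[OF f] rhom_add[OF f] rhom_mult[OF f])

lemma poly_loops_map:
  assumes f: "rhom f" and \<alpha>: "\<alpha> \<in> poly_loops"
  shows "map_matrix (map_poly f) \<alpha> \<in> poly_loops"
proof -
  \<comment> \<open>Evaluation is carried along at \<open>f x\<close>, not at \<open>x\<close>. This
    suffices because the base points 0 and 1 are fixed by every ring homomorphism.\<close>
  have "map_matrix (\<lambda>p. poly (map_poly f p) (f x)) \<alpha> = mat 1"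
    if "map_matrix (\<lambda>p. poly p x) \<alpha> = mat 1" for x
    using arg_cong[OF that, of "map_matrix f"]
    by (simp add: map_matrix_comp rhom_poly_map_poly[OF f] map_matrix_one[OF f])
  from this[of 0] this[of 1] show ?thesis
    using poly_loopsD[OF \<alpha>]
    by (simp add: poly_loops_def map_matrix_comp map_matrix_SL2 map_poly_rhom
        rhom_zero[OF f] rhom_one[OF f] f)
qed

lemma spec_S_map_poly:
  assumes f: "rhom f"
  shows "spec_S (f s) (map_poly (map_poly f) p) = map_poly f (spec_S s p)"
  using rhom_poly_map_poly[OF map_poly_rhom[OF f], of p "[:s:]"]
  by (simp add: spec_S_def map_poly_pCons rhom_zero[OF f])

lemma spec_T_map_poly:
  assumes f: "rhom f"
  shows "spec_T (f t) (map_poly (map_poly f) p) = map_poly f (spec_T t p)"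
  by (rule poly_eqI)
    (simp add: spec_T_def coeff_map_poly rhom_zero[OF f] rhom_poly_map_poly[OF f])

text \<open>Applying \<open>f\<close> to the coefficients of a homotopy commutes with specializing T
  or S at 0 and 1, so the image is again a homotopy of loops.\<close>

lemma loop_rel_map:
  assumes f: "rhom f" and ab: "(\<alpha>, \<beta>) \<in> loop_rel"
  shows "(map_matrix (map_poly f) \<alpha>, map_matrix (map_poly f) \<beta>) \<in> loop_rel"
proof -
  obtain \<gamma> where \<gamma>: "\<alpha> \<in> poly_loops" "\<beta> \<in> poly_loops" "\<gamma> \<in> SL2"
    "map_matrix (spec_S 0) \<gamma> = \<alpha>" "map_matrix (spec_S 1) \<gamma> = \<beta>"
    "map_matrix (spec_T 0) \<gamma> = mat 1" "map_matrix (spec_T 1) \<gamma> = mat 1"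
    using ab by (rule loop_relE)
  let ?F = "map_poly f"
  let ?\<gamma> = "map_matrix (map_poly ?F) \<gamma>"
  have F: "rhom ?F" by (rule map_poly_rhom[OF f])
  have S: "map_matrix (spec_S (f s)) ?\<gamma> = map_matrix ?F (map_matrix (spec_S s) \<gamma>)" for s
    by (simp add: map_matrix_comp spec_S_map_poly[OF f])
  have T: "map_matrix (spec_T (f t)) ?\<gamma> = map_matrix ?F (map_matrix (spec_T t) \<gamma>)" for t
    by (simp add: map_matrix_comp spec_T_map_poly[OF f])
  note f01 = rhom_zero[OF f] rhom_one[OF f]
  show ?thesis
  proof (rule loop_relI)
    show "?\<gamma> \<in> SL2" by (rule map_matrix_SL2[OF map_poly_rhom[OF F] \<gamma>(3)])
  qed (use S[of 0] S[of 1] T[of 0] T[of 1] \<gamma> in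
      \<open>simp_all add: f01 poly_loops_map[OF f] map_matrix_one[OF F]\<close>)
qed

text \<open>As for the product of classes, the union over representatives avoids a choice; by
  \<open>loop_rel_map\<close> all members of the union coincide.\<close>

definition pi1_map ::
  "('a::comm_ring_1 \<Rightarrow> 'b::comm_ring_1) \<Rightarrow> ('a poly ^ 2 ^ 2) set \<Rightarrow> ('b poly ^ 2 ^ 2) set" where
  "pi1_map f X = (\<Union>\<alpha>\<in>X. loop_rel `` {map_matrix (map_poly f) \<alpha>})"

lemma pi1_map_class:
  assumes f: "rhom f" and \<alpha>: "\<alpha> \<in> poly_loops"
  shows "pi1_map f (loop_rel `` {\<alpha>}) = loop_rel `` {map_matrix (map_poly f) \<alpha>}"
proof -
  have "loop_rel `` {map_matrix (map_poly f) \<beta>} = loop_rel `` {map_matrix (map_poly f) \<alpha>}"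
    if "\<beta> \<in> loop_rel `` {\<alpha>}" for \<beta>
    using that loop_rel_map[OF f loop_rel_sym[of \<alpha> \<beta>]]
    by (intro equiv_class_eq[OF equiv_loop_rel]) simp
  moreover have "\<alpha> \<in> loop_rel `` {\<alpha>}"
    by (simp add: loop_rel_refl \<alpha>)
  ultimately show ?thesis
    unfolding pi1_map_def by blast
qed

lemma pi1_map_hom:
  fixes f :: "'a::comm_ring_1 \<Rightarrow> 'b::comm_ring_1"
  assumes f: "rhom f"
  shows "pi1_map f \<in> hom (pi1_SL2 TYPE('a)) (pi1_SL2 TYPE('b))"
proof (rule homI)
  fix X assume "X \<in> carrier (pi1_SL2 TYPE('a))"
  then obtain \<alpha> where \<alpha>: "\<alpha> \<in> poly_loops" and X: "X = loop_rel `` {\<alpha>}"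
    unfolding pi1_SL2_carrier by blast
  show "pi1_map f X \<in> carrier (pi1_SL2 TYPE('b))"
    unfolding X pi1_map_class[OF f \<alpha>] pi1_SL2_carrier
    by (rule imageI[OF poly_loops_map[OF f \<alpha>]])
  fix Y assume "Y \<in> carrier (pi1_SL2 TYPE('a))"
  then obtain \<beta> where \<beta>: "\<beta> \<in> poly_loops" and Y: "Y = loop_rel `` {\<beta>}"
    unfolding pi1_SL2_carrier by blast
  show "pi1_map f (X \<otimes>\<^bsub>pi1_SL2 TYPE('a)\<^esub> Y) =
      pi1_map f X \<otimes>\<^bsub>pi1_SL2 TYPE('b)\<^esub> pi1_map f Y"
    by (simp only: X Y loop_class_mult[OF \<alpha> \<beta>] pi1_map_class[OF f \<alpha>] pi1_map_class[OF f \<beta>]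
        pi1_map_class[OF f poly_loops_mult[OF \<alpha> \<beta>]] map_matrix_mult[OF map_poly_rhom[OF f]]
        loop_class_mult[OF poly_loops_map[OF f \<alpha>] poly_loops_map[OF f \<beta>]])
qed

section \<open>Homotopic coefficient homomorphisms induce the same map on classes\<close>

text \<open>Applying \<open>h\<close> to the coefficients of an element of B[T] gives an element of
  B[S][T], but homotopies live in B[T][S]. Each \<open>h b\<close> is therefore embedded with
  coefficients constant in T, and the old variable is evaluated at T, which is
  \<open>[:[:0, 1:]:]\<close>.\<close>

definition coeff_homotopy ::
  "('b::comm_ring_1 \<Rightarrow> 'b poly) \<Rightarrow> 'b poly \<Rightarrow> 'b poly poly" where
  "coeff_homotopy h p = poly (map_poly (\<lambda>b. map_poly (\<lambda>c. [:c:]) (h b)) p) [:[:0, 1:]:]"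

context
  fixes h :: "'b::comm_ring_1 \<Rightarrow> 'b poly"
  assumes h: "rhom h"
begin

lemma coeff_homotopy_0 [simp]: "coeff_homotopy h 0 = 0"
  by (simp add: coeff_homotopy_def)

lemma coeff_homotopy_pCons:
  "coeff_homotopy h (pCons b p) = map_poly (\<lambda>c. [:c:]) (h b) + [:[:0, 1:]:] * coeff_homotopy h p"
  by (simp add: coeff_homotopy_def map_poly_pCons rhom_zero[OF h])

lemma coeff_homotopy_rhom: "rhom (coeff_homotopy h)"
  unfolding coeff_homotopy_def
  by (intro rhom_comp[OF poly_rhom] map_poly_rhom rhom_comp[OF map_poly_rhom] const_rhom h)

lemma spec_S_coeff_homotopy:
  "spec_S s (coeff_homotopy h p) = map_poly (\<lambda>b. poly (h b) s) p"
proof (induction p)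
  case (pCons b p)
  have "spec_S s (map_poly (\<lambda>c. [:c:]) (h b)) = [:poly (h b) s:]"
    unfolding spec_S_def by (rule rhom_poly_map_poly[OF const_rhom])
  then show ?case
    using pCons
    by (simp only: coeff_homotopy_pCons rhom_add[OF spec_S_rhom] rhom_mult[OF spec_S_rhom])
      (simp add: spec_S_def map_poly_pCons rhom_zero[OF h])
qed (simp add: spec_S_def)

text \<open>Specializing T puts the constant t where applying \<open>h\<close> after evaluation puts
  \<open>h t\<close>. The two agree when \<open>h\<close> fixes t, as it does for 0 and 1.\<close>

lemma spec_T_coeff_homotopy:
  assumes t: "h t = [:t:]"
  shows "spec_T t (coeff_homotopy h p) = h (poly p t)"
proof (induction p)
  case (pCons b p)
  have "spec_T t (map_poly (\<lambda>c. [:c:]) (h b)) = h b"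
    by (rule poly_eqI) (simp add: spec_T_def coeff_map_poly)
  moreover have "spec_T t [:[:0, 1:]:] = h t"
    by (simp add: spec_T_def map_poly_pCons t)
  ultimately show ?case
    using pCons
    by (simp only: coeff_homotopy_pCons rhom_add[OF spec_T_rhom] rhom_mult[OF spec_T_rhom])
      (simp add: rhom_add[OF h] rhom_mult[OF h])
qed (simp add: spec_T_def rhom_zero[OF h])

text \<open>The witness is \<open>coeff_homotopy h\<close> applied entrywise. Setting S to 0 or 1
  evaluates \<open>h\<close> there in each coefficient; at T = 0 and T = 1 what remains is
  \<open>h\<close> applied to the identity matrix.\<close>

lemma loop_rel_coeff_homotopy:
  assumes \<alpha>: "\<alpha> \<in> poly_loops"
  shows "(map_matrix (map_poly (\<lambda>b. poly (h b) 0)) \<alpha>,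
          map_matrix (map_poly (\<lambda>b. poly (h b) 1)) \<alpha>) \<in> loop_rel"
proof (rule loop_relI)
  let ?\<gamma> = "map_matrix (coeff_homotopy h) \<alpha>"
  show "?\<gamma> \<in> SL2"
    by (rule map_matrix_SL2[OF coeff_homotopy_rhom poly_loopsD(1)[OF \<alpha>]])
  have T: "map_matrix (spec_T t) ?\<gamma> = mat 1"
    if "h t = [:t:]" "map_matrix (\<lambda>p. poly p t) \<alpha> = mat 1" for t
    using arg_cong[OF that(2), of "map_matrix h"]
    by (simp add: map_matrix_comp spec_T_coeff_homotopy[OF that(1)] map_matrix_one[OF h])
  show "map_matrix (spec_T 0) ?\<gamma> = mat 1"
    by (rule T) (simp_all add: rhom_zero[OF h] poly_loopsD[OF \<alpha>])
  show "map_matrix (spec_T 1) ?\<gamma> = mat 1"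
    by (rule T) (simp_all add: rhom_one[OF h] poly_loopsD[OF \<alpha>])
qed (simp_all add: map_matrix_comp spec_S_coeff_homotopy poly_loops_map[OF _ \<alpha>]
    rhom_comp[OF poly_rhom h])

end

lemma map_poly_ident: "map_poly (\<lambda>x. x) = (\<lambda>p. p)"
  by (rule ext, rule poly_eqI) (simp add: coeff_map_poly)

lemma map_poly_comp_rhom:
  assumes "rhom f" "rhom g"
  shows "map_poly f (map_poly g p) = map_poly (\<lambda>x. f (g x)) p"
  by (rule poly_eqI) (simp add: coeff_map_poly rhom_zero assms)

text \<open>The composite \<open>r\<close> after \<open>i\<close> is the identity already on loops.
  The other composite is the identity only on classes, and \<open>h\<close> supplies the
  homotopy.\<close>

lemma pi1_SL2_iso_of_contraction:
  fixes i :: "'a::comm_ring_1 \<Rightarrow> 'b::comm_ring_1" and r :: "'b \<Rightarrow> 'a" and h :: "'b \<Rightarrow> 'b poly"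
  assumes i: "rhom i" and r: "rhom r" and h: "rhom h"
    and ri: "\<And>a. r (i a) = a"
    and h0: "\<And>b. poly (h b) 0 = i (r b)" and h1: "\<And>b. poly (h b) 1 = b"
  shows "pi1_SL2 TYPE('b) \<cong> pi1_SL2 TYPE('a)"
proof (rule is_isoI, rule isoI)
  show hom: "pi1_map r \<in> hom (pi1_SL2 TYPE('b)) (pi1_SL2 TYPE('a))"
    by (rule pi1_map_hom[OF r])
  have "pi1_map i (pi1_map r (loop_rel `` {\<alpha>})) = loop_rel `` {\<alpha>}" if \<alpha>: "\<alpha> \<in> poly_loops" for \<alpha>
  proof -
    have "(map_matrix (map_poly (\<lambda>b. i (r b))) \<alpha>, \<alpha>) \<in> loop_rel"
      using loop_rel_coeff_homotopy[OF h \<alpha>] by (simp add: h0 h1 map_poly_ident map_matrix_ident)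
    then have "loop_rel `` {map_matrix (map_poly (\<lambda>b. i (r b))) \<alpha>} = loop_rel `` {\<alpha>}"
      by (rule equiv_class_eq[OF equiv_loop_rel])
    then show ?thesis
      by (simp only: pi1_map_class[OF r \<alpha>] pi1_map_class[OF i poly_loops_map[OF r \<alpha>]]
          map_matrix_comp map_poly_comp_rhom[OF i r])
  qed
  moreover have "pi1_map r (pi1_map i (loop_rel `` {\<alpha>})) = loop_rel `` {\<alpha>}"
    if \<alpha>: "\<alpha> \<in> poly_loops" for \<alpha>
    by (simp only: pi1_map_class[OF i \<alpha>] pi1_map_class[OF r poly_loops_map[OF i \<alpha>]]
        map_matrix_comp map_poly_comp_rhom[OF r i] ri map_poly_ident map_matrix_ident)
  ultimately have inv: "\<forall>X\<in>carrier (pi1_SL2 TYPE('b)). pi1_map i (pi1_map r X) = X"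
    "\<forall>X\<in>carrier (pi1_SL2 TYPE('a)). pi1_map r (pi1_map i X) = X"
    unfolding pi1_SL2_carrier by blast+
  show "bij_betw (pi1_map r) (carrier (pi1_SL2 TYPE('b))) (carrier (pi1_SL2 TYPE('a)))"
    by (rule bij_betw_byWitness[OF inv])
      (intro image_subsetI hom_in_carrier[OF hom] hom_in_carrier[OF pi1_map_hom[OF i]], assumption)+
qed

section \<open>Contraction of one variable\<close>

text \<open>The substitution of S X for X. The outer variable is S, so
  \<open>[:0, [:0, 1:]:]\<close> is the product S X.\<close>

definition poly_scale :: "'a::comm_ring_1 poly \<Rightarrow> 'a poly poly" where
  "poly_scale p = poly (map_poly (\<lambda>c. [:[:c:]:]) p) [:0, [:0, 1:]:]"

lemma poly_scale_rhom: "rhom poly_scale"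
  unfolding poly_scale_def
  by (intro rhom_comp[OF poly_rhom] map_poly_rhom rhom_comp[OF const_rhom] const_rhom)

lemma poly_poly_scale_0: "poly (poly_scale p) 0 = [:poly p 0:]"
  by (induction p) (simp_all add: poly_scale_def map_poly_pCons)

lemma poly_poly_scale_1: "poly (poly_scale p) 1 = p"
  by (induction p) (simp_all add: poly_scale_def map_poly_pCons)

lemma pi1_SL2_poly_iso: "pi1_SL2 TYPE('a::comm_ring_1 poly) \<cong> pi1_SL2 TYPE('a)"
  by (rule pi1_SL2_iso_of_contraction[OF const_rhom poly_rhom[of 0] poly_scale_rhom])
    (simp_all add: poly_poly_scale_0 poly_poly_scale_1)

section \<open>Contraction of finitely many variables\<close>

lemma poly_mapping_additive_eqI:
  fixes F G :: "('k \<Rightarrow>\<^sub>0 'a::comm_monoid_add) \<Rightarrow> 'b::comm_monoid_add"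
  assumes "\<And>p q. F (p + q) = F p + F q" "\<And>p q. G (p + q) = G p + G q" "F 0 = G 0"
    and "\<And>k a. F (Poly_Mapping.single k a) = G (Poly_Mapping.single k a)"
  shows "F p = G p"
proof (induction p rule: update_induct)
  case const
  show ?case by (fact assms(3))
next
  case (update p k a)
  \<comment> \<open>The key \<open>k\<close> is not in the support of \<open>p\<close>, so updating
    there is the same as adding a monomial.\<close>
  have "Poly_Mapping.update k a p = p + Poly_Mapping.single k a"
    using update(1) by (intro poly_mapping_eqI)
      (auto simp: lookup_update lookup_add lookup_single when_def in_keys_iff)
  with update show ?case by (simp add: assms)
qed

text \<open>Both sides are biadditive, so multiplicativity on monomials extends first in
  \<open>q\<close>, then in \<open>p\<close>.\<close>

lemma poly_mapping_multiplicativeI: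
  fixes F :: "('k::monoid_add \<Rightarrow>\<^sub>0 'a::comm_ring_1) \<Rightarrow> 'b::comm_ring_1"
  assumes add: "\<And>p q. F (p + q) = F p + F q"
    and mult: "\<And>k l a b. F (Poly_Mapping.single (k + l) (a * b)) =
                F (Poly_Mapping.single k a) * F (Poly_Mapping.single l b)"
  shows "F (p * q) = F p * F q"
proof -
  have zero: "F 0 = 0"
    using add[of 0 0] by simp
  have single: "F (Poly_Mapping.single k a * q) = F (Poly_Mapping.single k a) * F q" for k a
    by (rule poly_mapping_additive_eqI[where p = q])
      (simp_all add: add zero mult mult_single distrib_left)
  show ?thesis
    by (rule poly_mapping_additive_eqI[where p = p])
      (simp_all add: add zero single distrib_right)
qed

definition mdeg :: "('n::finite \<Rightarrow>\<^sub>0 nat) \<Rightarrow> nat" where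
  "mdeg m = (\<Sum>i\<in>UNIV. Poly_Mapping.lookup m i)"

lemma mdeg_zero [simp]: "mdeg 0 = 0"
  by (simp add: mdeg_def)

lemma mdeg_add: "mdeg (m + n) = mdeg m + mdeg n"
  by (simp add: mdeg_def lookup_add sum.distrib)

lemma mdeg_eq_0_iff: "mdeg m = 0 \<longleftrightarrow> m = 0"
  by (auto simp: mdeg_def poly_mapping_eq_iff fun_eq_iff)

text \<open>All variables are scaled by S at once: a monomial picks up S to the power of its total
  degree. This makes an induction on the number of variables unnecessary.\<close>

definition mpoly_scale :: "('a::comm_ring_1, 'n::finite) mpoly \<Rightarrow> ('a, 'n) mpoly poly" where
  "mpoly_scale p = (\<Sum>m\<in>Poly_Mapping.keys p.
     monom (Poly_Mapping.single m (Poly_Mapping.lookup p m)) (mdeg m))"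

lemma mpoly_scale_superset:
  assumes "finite K" "Poly_Mapping.keys p \<subseteq> K"
  shows "mpoly_scale p = (\<Sum>m\<in>K. monom (Poly_Mapping.single m (Poly_Mapping.lookup p m)) (mdeg m))"
  unfolding mpoly_scale_def using assms
  by (intro sum.mono_neutral_left) (auto simp: in_keys_iff)

lemma mpoly_scale_add: "mpoly_scale (p + q) = mpoly_scale p + mpoly_scale q"
proof -
  let ?K = "Poly_Mapping.keys p \<union> Poly_Mapping.keys q"
  \<comment> \<open>Cancellation can shrink the support of \<open>p + q\<close>; over the common
    index set \<open>?K\<close> the three sums compare termwise.\<close>
  have "mpoly_scale u = (\<Sum>m\<in>?K. monom (Poly_Mapping.single m (Poly_Mapping.lookup u m)) (mdeg m))"
    if "u \<in> {p, q, p + q}" for u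
    using that Poly_Mapping.keys_add[of p q] by (intro mpoly_scale_superset) auto
  then show ?thesis
    by (simp add: lookup_add single_add add_monom[symmetric] sum.distrib)
qed

lemma mpoly_scale_single:
  "mpoly_scale (Poly_Mapping.single m a) = monom (Poly_Mapping.single m a) (mdeg m)"
  by (subst mpoly_scale_superset[of "{m}"]) simp_all

lemma mpoly_scale_rhom:
  "rhom (mpoly_scale :: ('a::comm_ring_1, 'n::finite) mpoly \<Rightarrow> ('a, 'n) mpoly poly)"
proof (rule rhomI)
  show "mpoly_scale 1 = (1 :: ('a, 'n) mpoly poly)"
    using mpoly_scale_single[of 0 "1::'a"] by simp
  show "mpoly_scale (p * q) = mpoly_scale p * mpoly_scale q" for p q :: "('a, 'n) mpoly"
    by (rule poly_mapping_multiplicativeI[OF mpoly_scale_add])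
      (simp add: mpoly_scale_single mult_monom mult_single mdeg_add)
qed (rule mpoly_scale_add)

text \<open>At S = 0 only monomials of total degree 0 survive, and the zero exponent is the only one
  of that degree.\<close>

lemma poly_mpoly_scale_0:
  "poly (mpoly_scale p) 0 = Poly_Mapping.single 0 (Poly_Mapping.lookup p 0)"
  by (rule poly_mapping_additive_eqI[where p = p])
    (auto simp: mpoly_scale_add lookup_add single_add mpoly_scale_single poly_monom
      power_0_left mdeg_eq_0_iff lookup_single when_def mpoly_scale_def[of 0])

lemma poly_mpoly_scale_1: "poly (mpoly_scale p) 1 = p"
  by (rule poly_mapping_additive_eqI[where p = p])
    (simp_all add: mpoly_scale_add mpoly_scale_single poly_monom mpoly_scale_def[of 0])

lemma single_zero_rhom: "rhom (Poly_Mapping.single 0 :: 'a::comm_ring_1 \<Rightarrow> ('a, 'n::finite) mpoly)"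
  by (rule rhomI) (simp_all add: single_add mult_single)

lemma lookup_zero_rhom: "rhom (\<lambda>p :: ('a::comm_ring_1, 'n::finite) mpoly. Poly_Mapping.lookup p 0)"
proof (rule rhomI)
  \<comment> \<open>Exponents are natural numbers, so no cancellation occurs: only the two constant
    terms contribute to the constant term of a product.\<close>
  have "m + n = 0 \<longleftrightarrow> m = 0 \<and> n = 0" for m n :: "'n \<Rightarrow>\<^sub>0 nat"
    using mdeg_add[of m n] by (auto simp: mdeg_eq_0_iff[symmetric])
  then show "Poly_Mapping.lookup (p * q) 0 = Poly_Mapping.lookup p 0 * Poly_Mapping.lookup q 0"
    for p q :: "('a, 'n) mpoly"
    by (intro poly_mapping_multiplicativeI[where F = "\<lambda>p. Poly_Mapping.lookup p 0"])
      (auto simp: lookup_add lookup_single when_def)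
qed (simp_all add: lookup_add lookup_one)

lemma pi1_SL2_mpoly_iso: "pi1_SL2 TYPE(('a::comm_ring_1, 'n::finite) mpoly) \<cong> pi1_SL2 TYPE('a)"
  by (rule pi1_SL2_iso_of_contraction[OF single_zero_rhom lookup_zero_rhom mpoly_scale_rhom])
    (simp_all add: poly_mpoly_scale_0 poly_mpoly_scale_1)

theorem theorem3p1:
  shows "pi1_SL2 TYPE('a::comm_ring_1 poly) \<cong> pi1_SL2 TYPE('a) \<and>
         pi1_SL2 TYPE(('a, 'n::finite) mpoly) \<cong> pi1_SL2 TYPE('a)"
  by (intro conjI pi1_SL2_poly_iso pi1_SL2_mpoly_iso)

end
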